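(* Consider the uncertain system $$x_{k+1}=Ax_k+Bu_k+B_dd_k+B_ww_k,\quad e_k=C_ex_k+D_{eu}u_k+D_{ed}d_k,\quad z_k=C_zx_k+D_zu_k,\quad w_k=\Delta z_k,$$ the data $(X_+,X,U)$, the prior uncertainty set $\boldsymbol{\Delta}_{\rm prior}$ and the disturbance set $\boldsymbol{D}$, all as specified in the context (in particular $\boldsymbol{\Delta}_{\rm prior}$ and $\boldsymbol{D}$ satisfy the multiplier assumptions (A1) and (A2) there), together with the resulting set $\boldsymbol{\Delta}_{\rm com}$ and multiplier class $\tilde{\boldsymbol{P}}_{\rm com}$ defined there. Suppose $D_{ed}=0$ and that there exist a symmetric $\mathcal{X}\in\mathbb{R}^{n\times n}$ with $\mathcal{X}\succ0$, a matrix $K\in\mathbb{R}^{m\times n}$, $\tilde{P}_{\rm com}\in\tilde{\boldsymbol{P}}_{\rm com}$ and $\gamma>0$ such that $$\mathrm{tr}\big((C_e+D_{eu}K)\mathcal{X}(C_e+D_{eu}K)^\top\big)<\gamma^2$$ and $$\begin{bmatrix} I & 0 \\ (A+BK)^\top & (C_z+D_zK)^\top \\ 0 & I \\ I & 0 \end{bmatrix}^\top \begin{bmatrix} B_dB_d^\top-\mathcal{X} & 0 & 0 \\ 0 & \mathcal{X} & 0 \\ 0 & 0 & \tilde{P}_{\rm com} \end{bmatrix} \begin{bmatrix} I & 0 \\ (A+BK)^\top & (C_z+D_zK)^\top \\ 0 & I \\ I & 0 \end{bmatrix}\prec0 .$$ (Here the block columns of the outer factor have widths $n$ and $n_z$,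 the last two block rows have heights $n_z$ and $n$, and $\tilde P_{\rm com}$ has size $(n_z+n)\times(n_z+n)$.) Then, for every $\Delta\in\boldsymbol{\Delta}_{\rm com}$, the system controlled by $u_k=Kx_k$ is stable, and the closed-loop map $d\mapsto e$ has $\mathcal{H}_2$-norm less than $\gamma$.
   Context: All matrices are real; $\succ,\succeq,\prec,\preceq$ refer to (semi)definiteness of symmetric matrices. Dimensions: $x_k\in\mathbb{R}^n$, $u_k\in\mathbb{R}^m$, $d_k\in\mathbb{R}^{n_d}$, $e_k\in\mathbb{R}^{n_e}$, $w_k\in\mathbb{R}^{n_w}$, $z_k\in\mathbb{R}^{n_z}$. The matrices $A,B,B_d,B_w,C_e,D_{eu},D_{ed},C_z,D_z$ are given (known), and $B_d$ has full column rank. A convex cone of symmetric matrices "admits an LMI representation" if it is the projection of the solution set of a strictly feasible linear matrix inequality. (A1) Prior knowledge. Uncertainties are block diagonal, $\Delta=\mathrm{diag}_{j=1}^{\ell}(\Delta_j)=\sum_{j=1}^{\ell}R_j\Delta_jL_j^\top$ with $\Delta_j\in\mathbb{R}^{n_{w,j}\times n_{z,j}}$, $\sum_j n_{w,j}=n_w$, $\sum_j n_{z,j}=n_z$, where $L_j$ and $R_j$ are the corresponding block columns of $I_{n_z}$ and $I_{n_w}$. Put $B_j=B_wR_j$, so $B_w=[B_1\ \cdots\ B_\ell]$; each $B_j$ has full column rank. The prior set is $\boldsymbol{\Delta}_{\rm prior}=\{\mathrm{diag}_{j=1}^\ell(\Delta_j)\mid\Delta_j\in\boldsymbol{\Delta}_j\}$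 with $$\boldsymbol{\Delta}_j=\Big\{\Delta_j\in\mathbb{R}^{n_{w,j}\times n_{z,j}}\ \Big|\ \begin{bmatrix} \Delta_j^\top \\ I \end{bmatrix}^\top P_j\begin{bmatrix} \Delta_j^\top \\ I \end{bmatrix}\succeq0\ \ \forall P_j\in\boldsymbol{P}_j\Big\},$$ where $\boldsymbol{P}_j$ is a convex cone of symmetric matrices of size $n_{z,j}+n_{w,j}$ admitting an LMI representation, and for each $j$ some $P_j\in\boldsymbol{P}_j$ has negative definite left-upper $n_{z,j}\times n_{z,j}$ block. (A2) Disturbance. $$\boldsymbol{D}=\Big\{D\in\mathbb{R}^{n_d\times N}\ \Big|\ \begin{bmatrix} D^\top \\ I \end{bmatrix}^\top P_d\begin{bmatrix} D^\top \\ I \end{bmatrix}\succeq0\ \ \forall P_d\in\boldsymbol{P}_d\Big\},$$ where $\boldsymbol{P}_d$ is a convex cone of symmetric matrices of size $N+n_d$ admitting an LMI representation, and some $P_d\in\boldsymbol{P}_d$ has negative definite left-upper $N\times N$ block. Data. A trajectory $\{x_k\}_{k=0}^N$, $\{u_k\}_{k=0}^{N-1}$ of the system is given, generated with some (unknown) $\Delta_{\rm tr}\in\boldsymbol{\Delta}_{\rm prior}$ and some (unknown) disturbance matrix $D_{\rm tr}=[\hat d_0\ \cdots\ \hat d_{N-1}]\in\boldsymbol{D}$. Set $X=[x_0\ \cdots\ x_{N-1}]$, $X_+=[x_1\ \cdots\ x_N]$, $U=[u_0\ \cdots\ u_{N-1}]$, $M=X_+-AX-BU$, $Z=C_zX+D_zU$.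 Sets. $\boldsymbol{\Delta}_{\rm learnt}=\{\Delta\in\mathbb{R}^{n_w\times n_z}\mid M=B_w\Delta Z+B_dD\text{ for some }D\in\boldsymbol{D}\}$ and $\boldsymbol{\Delta}_{\rm com}=\boldsymbol{\Delta}_{\rm prior}\cap\boldsymbol{\Delta}_{\rm learnt}$. Multipliers. $$\tilde{\boldsymbol{P}}=\sum_{j=1}^{\ell}\begin{bmatrix} L_j^\top & 0 \\ 0 & B_j^\top \end{bmatrix}^\top\boldsymbol{P}_j\begin{bmatrix} L_j^\top & 0 \\ 0 & B_j^\top \end{bmatrix},\qquad \tilde{\boldsymbol{P}}_0=\begin{bmatrix} -Z^\top & M^\top \\ 0 & B_d^\top \end{bmatrix}^\top\boldsymbol{P}_d\begin{bmatrix} -Z^\top & M^\top \\ 0 & B_d^\top \end{bmatrix},$$ $\tilde{\boldsymbol{P}}_{\rm com}=\tilde{\boldsymbol{P}}+\tilde{\boldsymbol{P}}_0$ (images and sums of sets are taken elementwise / in the Minkowski sense). "Stable" means that the closed-loop matrix $A+BK+B_w\Delta(C_z+D_zK)$ has all eigenvalues in the open unit disk. The $\mathcal{H}_2$-norm of a stable discrete-time system $x_{k+1}=\mathcal{A}x_k+\mathcal{B}d_k$, $e_k=\mathcal{C}x_k$ is the nonnegative square root of $\mathrm{tr}\big(\sum_{k\ge0}\mathcal{C}\mathcal{A}^k\mathcal{B}\mathcal{B}^\top(\mathcal{A}^\top)^k\mathcal{C}^\top\big)$. *)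

theory Defs
  imports
    Complex_Main
    "Jordan_Normal_Form.Char_Poly"
    "Jordan_Normal_Form.DL_Rank"
begin

definition sym_mats :: "nat \<Rightarrow> real mat set" where
  "sym_mats r = {P \<in> carrier_mat r r. P\<^sup>T = P}"

definition pos_semidef :: "real mat \<Rightarrow> bool" where
  "pos_semidef P \<longleftrightarrow> P \<in> sym_mats (dim_row P) \<and>
     (\<forall>v \<in> carrier_vec (dim_row P). v \<bullet> (P *\<^sub>v v) \<ge> 0)"

definition pos_def :: "real mat \<Rightarrow> bool" where
  "pos_def P \<longleftrightarrow> P \<in> sym_mats (dim_row P) \<and>
     (\<forall>v \<in> carrier_vec (dim_row P). v \<noteq> 0\<^sub>v (dim_row P) \<longrightarrow> v \<bullet> (P *\<^sub>v v) > 0)"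

definition neg_def :: "real mat \<Rightarrow> bool" where
  "neg_def P \<longleftrightarrow> pos_def (- P)"

definition congruence :: "real mat \<Rightarrow> real mat \<Rightarrow> real mat" where
  "congruence T P = T\<^sup>T * P * T"

definition mat_trace :: "real mat \<Rightarrow> real" where
  "mat_trace P = (\<Sum>i<dim_row P. P $$ (i, i))"

text \<open>
  Matrices of different sizes share one type, so matrix addition has no neutral element and
  the library's \<open>sum\<close> does not apply; finite sums of \<open>r \<times> c\<close> matrices are formed entrywise.
\<close>

definition mat_sum :: "nat \<Rightarrow> nat \<Rightarrow> (nat \<Rightarrow> real mat) \<Rightarrow> nat \<Rightarrow> real mat" where
  "mat_sum r c F k = mat r c (\<lambda>ij. \<Sum>t<k. F t $$ ij)"

text \<open>
  Scaling factors are strictly positive, so a cone need not contain \<open>0\<close>.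
\<close>

definition convex_cone :: "real mat set \<Rightarrow> bool" where
  "convex_cone \<P> \<longleftrightarrow> (\<forall>P \<in> \<P>. \<forall>Q \<in> \<P>. \<forall>a > 0. \<forall>b > 0. a \<cdot>\<^sub>m P + b \<cdot>\<^sub>m Q \<in> \<P>)"

text \<open>
  A linear matrix inequality \<open>F0 + y\<^sub>0 F\<^sub>0 + \<dots> + y\<^bsub>k-1\<^esub> F\<^bsub>k-1\<^esub> \<succeq> 0\<close> in the unknown \<open>y \<in> \<real>\<^sup>k\<close>, and
  the projection \<open>y \<mapsto> y\<^sub>0 E\<^sub>0 + \<dots> + y\<^bsub>k-1\<^esub> E\<^bsub>k-1\<^esub>\<close> of its solution set into the symmetric
  \<open>r \<times> r\<close> matrices. The projection is an arbitrary linear map because the cones may have empty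
  interior in the space of all symmetric matrices (e.g. \<open>{y diag(-I, I) | y \<ge> 0}\<close>).
\<close>

definition lmi_representable :: "nat \<Rightarrow> real mat set \<Rightarrow> bool" where
  "lmi_representable r \<P> \<longleftrightarrow>
     (\<exists>k s F0 F E.
        F0 \<in> sym_mats s \<and> (\<forall>i<k. F i \<in> sym_mats s \<and> E i \<in> sym_mats r) \<and>
        (let lmi = (\<lambda>y :: nat \<Rightarrow> real. F0 + mat_sum s s (\<lambda>i. y i \<cdot>\<^sub>m F i) k) in
          (\<exists>y. pos_def (lmi y)) \<and>
          \<P> = {mat_sum r r (\<lambda>i. y i \<cdot>\<^sub>m E i) k | y. pos_semidef (lmi y)}))"

definition multiplier_cone :: "nat \<Rightarrow> nat \<Rightarrow> real mat set \<Rightarrow> bool" where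
  "multiplier_cone q p \<P> \<longleftrightarrow>
     \<P> \<subseteq> sym_mats (q + p) \<and> convex_cone \<P> \<and> lmi_representable (q + p) \<P> \<and>
     (\<exists>P \<in> \<P>. neg_def (mat q q (\<lambda>ij. P $$ ij)))"

definition multiplier_set :: "nat \<Rightarrow> nat \<Rightarrow> real mat set \<Rightarrow> real mat set" where
  "multiplier_set p q \<P> =
     {D \<in> carrier_mat p q. \<forall>P \<in> \<P>. pos_semidef (congruence (D\<^sup>T @\<^sub>r 1\<^sub>m p) P)}"

text \<open>
  Blocks are numbered \<open>0, \<dots>, l - 1\<close>. For a partition of the columns of \<open>T\<close> into blocks of
  widths \<open>b 0, b 1, \<dots>\<close>, this is the \<open>j\<close>-th block column.
\<close>

definition block_col :: "real mat \<Rightarrow> (nat \<Rightarrow> nat) \<Rightarrow> nat \<Rightarrow> real mat" where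
  "block_col T b j = mat (dim_row T) (b j) (\<lambda>(i, k). T $$ (i, (\<Sum>t<j. b t) + k))"

definition prior_set ::
  "nat \<Rightarrow> (nat \<Rightarrow> nat) \<Rightarrow> (nat \<Rightarrow> nat) \<Rightarrow> (nat \<Rightarrow> real mat set) \<Rightarrow> real mat set" where
  "prior_set l nwb nzb Ps =
     {diag_block_mat (map \<Delta>s [0..<l]) | \<Delta>s. \<forall>j<l. \<Delta>s j \<in> multiplier_set (nwb j) (nzb j) (Ps j)}"

definition learnt_set ::
  "nat \<Rightarrow> nat \<Rightarrow> real mat \<Rightarrow> real mat \<Rightarrow> real mat \<Rightarrow> real mat \<Rightarrow> real mat set \<Rightarrow> real mat set" where
  "learnt_set nw nz Bw Bd M Z \<D> =
     {\<Delta> \<in> carrier_mat nw nz. \<exists>D \<in> \<D>. M = Bw * \<Delta> * Z + Bd * D}"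

definition trajectory ::
  "real mat \<Rightarrow> real mat \<Rightarrow> real mat \<Rightarrow> real mat \<Rightarrow> real mat \<Rightarrow> real mat \<Rightarrow> real mat \<Rightarrow> real mat \<Rightarrow> real mat
    \<Rightarrow> real mat \<Rightarrow> nat \<Rightarrow> (nat \<Rightarrow> real vec) \<Rightarrow> (nat \<Rightarrow> real vec) \<Rightarrow> (nat \<Rightarrow> real vec) \<Rightarrow> (nat \<Rightarrow> real vec) \<Rightarrow> bool"
where
  "trajectory A B Bd Bw Ce Deu Ded Cz Dz \<Delta> N x u d e \<longleftrightarrow>
     (\<forall>k\<le>N. x k \<in> carrier_vec (dim_row A)) \<and>
     (\<forall>k<N. u k \<in> carrier_vec (dim_col B) \<and> d k \<in> carrier_vec (dim_col Bd) \<and>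
        (let z = Cz *\<^sub>v x k + Dz *\<^sub>v u k; w = \<Delta> *\<^sub>v z in
           x (Suc k) = A *\<^sub>v x k + B *\<^sub>v u k + Bd *\<^sub>v d k + Bw *\<^sub>v w \<and>
           e k = Ce *\<^sub>v x k + Deu *\<^sub>v u k + Ded *\<^sub>v d k))"

definition prior_multipliers ::
  "nat \<Rightarrow> (nat \<Rightarrow> nat) \<Rightarrow> (nat \<Rightarrow> nat) \<Rightarrow> nat \<Rightarrow> real mat \<Rightarrow> (nat \<Rightarrow> real mat set) \<Rightarrow> real mat set" where
  "prior_multipliers l nwb nzb nz Bw Ps =
     (let L = block_col (1\<^sub>m nz) nzb;
          R = block_col (1\<^sub>m (dim_col Bw)) nwb;
          n = dim_row Bw;
          T = (\<lambda>j. four_block_mat (L j)\<^sup>T (0\<^sub>m (nzb j) n) (0\<^sub>m (nwb j) nz) (Bw * R j)\<^sup>T)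
      in {mat_sum (nz + n) (nz + n) (\<lambda>j. congruence (T j) (P j)) l | P. \<forall>j<l. P j \<in> Ps j})"

definition data_multipliers ::
  "real mat \<Rightarrow> real mat \<Rightarrow> real mat \<Rightarrow> real mat set \<Rightarrow> real mat set" where
  "data_multipliers Bd M Z Pd =
     congruence (four_block_mat (- (Z\<^sup>T)) (M\<^sup>T) (0\<^sub>m (dim_col Bd) (dim_row Z)) (Bd\<^sup>T)) ` Pd"

definition minkowski_sum :: "real mat set \<Rightarrow> real mat set \<Rightarrow> real mat set" where
  "minkowski_sum \<P> \<Q> = {P + Q | P Q. P \<in> \<P> \<and> Q \<in> \<Q>}"

definition schur_stable :: "real mat \<Rightarrow> bool" where
  "schur_stable \<A> \<longleftrightarrow> (\<forall>\<mu>. eigenvalue (map_mat complex_of_real \<A>) \<mu> \<longrightarrow> cmod \<mu> < 1)"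

text \<open>
  The matrix series is taken entrywise; it converges for stable \<open>\<A>\<close>, and only then is the value
  meaningful.
\<close>

definition h2_norm :: "real mat \<Rightarrow> real mat \<Rightarrow> real mat \<Rightarrow> real" where
  "h2_norm \<A> \<B> \<C> =
     sqrt (mat_trace (mat (dim_row \<C>) (dim_row \<C>)
       (\<lambda>ij. \<Sum>k. (\<C> * \<A> ^\<^sub>m k * \<B> * \<B>\<^sup>T * (\<A>\<^sup>T) ^\<^sub>m k * \<C>\<^sup>T) $$ ij)))"

end

theory Submission
  imports Defs
begin

text \<open>
  Fix \<open>\<Delta> \<in> \<Delta>\<^sub>c\<^sub>o\<^sub>m\<close> and let \<open>\<A>\<close> be the closed-loop matrix. Testing the matrix inequality on the vectors
  \<open>(v, \<Delta>\<^sup>T B\<^sub>w\<^sup>T v)\<close> turns its first two terms into the quadratic form of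
  \<open>\<A> \<X> \<A>\<^sup>T - \<X> + B\<^sub>d B\<^sub>d\<^sup>T\<close>, while the multiplier term is nonnegative: its \<open>j\<close>-th prior part is the form of
  \<open>P\<^sub>j\<close> at \<open>(\<Delta>\<^sub>j\<^sup>T y, y)\<close> with \<open>y = B\<^sub>j\<^sup>T v\<close>, and its data part is the form of \<open>P\<^sub>d\<close> at \<open>(D\<^sup>T y, y)\<close> with
  \<open>y = B\<^sub>d\<^sup>T v\<close>, because \<open>M\<^sup>T v = Z\<^sup>T \<Delta>\<^sup>T B\<^sub>w\<^sup>T v + D\<^sup>T B\<^sub>d\<^sup>T v\<close>. Hence
  \<open>\<A> \<X> \<A>\<^sup>T - \<X> + B\<^sub>d B\<^sub>d\<^sup>T \<prec> 0\<close>. Evaluating this at an eigenvector of \<open>\<A>\<^sup>T\<close> gives stability, and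
  telescoping it along \<open>(\<A>\<^sup>T)\<^sup>k c\<close> for each row \<open>c\<close> of \<open>C\<^sub>e + D\<^sub>e\<^sub>u K\<close> bounds the controllability Gramian by \<open>\<X>\<close>.
\<close>

section \<open>Quadratic forms: congruence, sums and block structure\<close>

definition quad :: "real mat \<Rightarrow> real vec \<Rightarrow> real" where
  "quad P v = v \<bullet> (P *\<^sub>v v)"

lemma zero_mat_mult_vec: "v \<in> carrier_vec c \<Longrightarrow> 0\<^sub>m r c *\<^sub>v (v :: real vec) = 0\<^sub>v r"
  by (intro eq_vecI) auto

lemma congruence_carrier: "T \<in> carrier_mat r c \<Longrightarrow> congruence T P \<in> carrier_mat c c"
  by (rule carrier_matI) (simp_all add: congruence_def)

text \<open>Transposition moves the left factor \<open>T\<^sup>T\<close> across the scalar product.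
  All multiplier classes and the matrix inequality are evaluated this way: the test vector is pushed
  through the outer factor, and the inner matrix is tested at the image.\<close>

lemma quad_congruence:
  assumes "T \<in> carrier_mat r c" "P \<in> carrier_mat r r" "v \<in> carrier_vec c"
  shows "quad (congruence T P) v = quad P (T *\<^sub>v v)"
proof -
  have "congruence T P *\<^sub>v v = (T\<^sup>T * P) *\<^sub>v (T *\<^sub>v v)"
    unfolding congruence_def using assms by (intro assoc_mult_mat_vec[of _ c r _ c]) auto
  also have "\<dots> = T\<^sup>T *\<^sub>v (P *\<^sub>v (T *\<^sub>v v))"
    using assms by (intro assoc_mult_mat_vec[of _ c r _ r]) auto
  finally have "congruence T P *\<^sub>v v = T\<^sup>T *\<^sub>v (P *\<^sub>v (T *\<^sub>v v))" .
  then have "quad (congruence T P) v = (T\<^sup>T *\<^sub>v (P *\<^sub>v (T *\<^sub>v v))) \<bullet> v"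
    unfolding quad_def using assms by (simp add: comm_scalar_prod[of _ c])
  also have "\<dots> = (P *\<^sub>v (T *\<^sub>v v)) \<bullet> (T *\<^sub>v v)"
    using assms by (intro transpose_vec_mult_scalar) auto
  also have "\<dots> = quad P (T *\<^sub>v v)"
    unfolding quad_def using assms by (intro comm_scalar_prod[of _ r]) auto
  finally show ?thesis .
qed

lemma quad_add:
  assumes "P \<in> carrier_mat r r" "Q \<in> carrier_mat r r" "v \<in> carrier_vec r"
  shows "quad (P + Q) v = quad P v + quad Q v"
  unfolding quad_def using assms
  by (simp add: add_mult_distrib_mat_vec[of _ r r] scalar_prod_add_distrib[of _ r])

lemma quad_uminus:
  assumes "P \<in> carrier_mat r r" "v \<in> carrier_vec r"
  shows "quad (- P) v = - quad P v"
  unfolding quad_def using assms by (simp add: uminus_mult_mat_vec)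

lemma quad_minus:
  assumes "P \<in> carrier_mat r r" "Q \<in> carrier_mat r r" "v \<in> carrier_vec r"
  shows "quad (P - Q) v = quad P v - quad Q v"
  unfolding quad_def using assms
  by (simp add: minus_mult_distrib_mat_vec[of _ r r] scalar_prod_minus_distrib[of _ r])

lemma quad_gram:
  assumes "T \<in> carrier_mat r c" "v \<in> carrier_vec r"
  shows "quad (T * T\<^sup>T) v = (T\<^sup>T *\<^sub>v v) \<bullet> (T\<^sup>T *\<^sub>v v)"
proof -
  have "quad (T * T\<^sup>T) v = v \<bullet> (T *\<^sub>v (T\<^sup>T *\<^sub>v v))"
    unfolding quad_def using assms by (simp add: assoc_mult_mat_vec[of _ r c])
  then show ?thesis
    using assms by (simp add: transpose_vec_mult_scalar[of _ r c])
qed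

lemma quad_block_diag:
  assumes "P \<in> carrier_mat p p" "Q \<in> carrier_mat q q" "v \<in> carrier_vec p" "w \<in> carrier_vec q"
  shows "quad (four_block_mat P (0\<^sub>m p q) (0\<^sub>m q p) Q) (v @\<^sub>v w) = quad P v + quad Q w"
  unfolding quad_def mult_mat_vec_split[OF assms] using assms
  by (intro scalar_prod_append) auto

lemma quad_mat_sum:
  assumes "\<forall>t<k. F t \<in> carrier_mat r r" "v \<in> carrier_vec r"
  shows "quad (mat_sum r r F k) v = (\<Sum>t<k. quad (F t) v)"
  using assms(1)
proof (induction k)
  case 0
  have "mat_sum r r F 0 = 0\<^sub>m r r" by (intro eq_matI) (auto simp: mat_sum_def)
  then show ?case using assms(2) by (simp add: quad_def zero_mat_mult_vec)
next
  case (Suc k)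
  have "mat_sum r r F (Suc k) = mat_sum r r F k + F k"
    using Suc.prems by (intro eq_matI) (auto simp: mat_sum_def)
  then show ?case
    using Suc quad_add[of "mat_sum r r F k" r "F k" v] assms(2) by (auto simp: mat_sum_def)
qed

text \<open>
  The real counterpart of \<open>(\<mu>z)\<^sup>* P (\<mu>z) = \<bar>\<mu>\<bar>\<^sup>2 z\<^sup>* P z\<close> for \<open>\<mu> = s + it\<close> and \<open>z = a + ib\<close>.
\<close>

lemma quad_rotation:
  assumes "P \<in> carrier_mat r r" "a \<in> carrier_vec r" "b \<in> carrier_vec r"
  shows "quad P (s \<cdot>\<^sub>v a - t \<cdot>\<^sub>v b) + quad P (s \<cdot>\<^sub>v b + t \<cdot>\<^sub>v a) = (s\<^sup>2 + t\<^sup>2) * (quad P a + quad P b)"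
proof -
  have [simp]: "P *\<^sub>v a \<in> carrier_vec r" "P *\<^sub>v b \<in> carrier_vec r"
    "dim_row P = r" "dim_col P = r" "dim_vec a = r" "dim_vec b = r"
    using assms by auto
  have "P *\<^sub>v (s \<cdot>\<^sub>v a - t \<cdot>\<^sub>v b) = s \<cdot>\<^sub>v (P *\<^sub>v a) - t \<cdot>\<^sub>v (P *\<^sub>v b)"
    "P *\<^sub>v (s \<cdot>\<^sub>v b + t \<cdot>\<^sub>v a) = s \<cdot>\<^sub>v (P *\<^sub>v b) + t \<cdot>\<^sub>v (P *\<^sub>v a)"
    using assms
    by (simp_all add: mult_minus_distrib_mat_vec[of _ r r] mult_add_distrib_mat_vec[of _ r r]
        mult_mat_vec[of _ r r])
  then show ?thesis
    unfolding quad_def using assms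
    by (simp add: scalar_prod_add_distrib[of _ r] add_scalar_prod_distrib[of _ r]
        scalar_prod_minus_distrib[of _ r] minus_scalar_prod_distrib[of _ r] power2_eq_square algebra_simps)
qed

lemma pos_semidefD: "pos_semidef P \<Longrightarrow> P \<in> carrier_mat r r \<Longrightarrow> v \<in> carrier_vec r \<Longrightarrow> quad P v \<ge> 0"
  by (auto simp: pos_semidef_def quad_def)

lemma pos_defD:
  "pos_def P \<Longrightarrow> P \<in> carrier_mat r r \<Longrightarrow> v \<in> carrier_vec r \<Longrightarrow> v \<noteq> 0\<^sub>v r \<Longrightarrow> quad P v > 0"
  by (auto simp: pos_def_def quad_def)

lemma pos_def_quad_nonneg:
  assumes "pos_def P" "P \<in> carrier_mat r r" "v \<in> carrier_vec r"
  shows "quad P v \<ge> 0"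
  using pos_defD[OF assms] assms by (cases "v = 0\<^sub>v r") (auto simp: quad_def)

lemma neg_defD:
  assumes "neg_def P" "P \<in> carrier_mat r r" "v \<in> carrier_vec r" "v \<noteq> 0\<^sub>v r"
  shows "quad P v < 0"
  using pos_defD[of "- P" r v] assms quad_uminus[of P r v] by (auto simp: neg_def_def)

section \<open>Stability from a Lyapunov inequality\<close>

lemma mult_mat_zero_vec: "(A :: real mat) \<in> carrier_mat r c \<Longrightarrow> A *\<^sub>v 0\<^sub>v c = 0\<^sub>v r"
  by (intro eq_vecI) auto

text \<open>If z is an eigenvector of \<open>A\<^sup>T\<close> for \<mu>, passing from z to its
  image multiplies the Hermitian form of \<open>X\<close> by the squared modulus of \<mu>, so strict
  decrease forces this factor below 1. As \<open>quad\<close> is real, z is split into real and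
  imaginary parts and the two values are added.\<close>

lemma schur_stable_if_lyapunov:
  assumes A: "A \<in> carrier_mat n n" and X: "X \<in> carrier_mat n n" "pos_def X"
    and decr: "\<And>v. v \<in> carrier_vec n \<Longrightarrow> v \<noteq> 0\<^sub>v n \<Longrightarrow> quad X (A\<^sup>T *\<^sub>v v) < quad X v"
  shows "schur_stable A"
  unfolding schur_stable_def
proof (intro allI impI)
  fix \<mu> assume ev: "eigenvalue (map_mat complex_of_real A) \<mu>"
  let ?A = "map_mat complex_of_real A"
  have cA: "?A \<in> carrier_mat n n" "?A\<^sup>T \<in> carrier_mat n n" using A by auto
  \<comment> \<open>A matrix and its transpose have the same characteristic polynomial, hence the
    same eigenvalues.\<close>
  have "eigenvalue (?A\<^sup>T) \<mu>"
    using ev eigenvalue_root_char_poly[OF cA(1)] eigenvalue_root_char_poly[OF cA(2)]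
      char_poly_transpose_mat[OF cA(1)] by simp
  then obtain v where v: "v \<in> carrier_vec n" "v \<noteq> 0\<^sub>v n" "?A\<^sup>T *\<^sub>v v = \<mu> \<cdot>\<^sub>v v"
    using A by (auto simp: eigenvalue_def eigenvector_def)
  define a b where "a = map_vec Re v" and "b = map_vec Im v"
  have ab: "a \<in> carrier_vec n" "b \<in> carrier_vec n" using v by (auto simp: a_def b_def)
  \<comment> \<open>The eigenvector equation by coordinates; its real and imaginary parts are
    \<open>Aa\<close> and \<open>Ab\<close>, the shape required by
    \<open>quad_rotation\<close>.\<close>
  have comp: "(\<Sum>j = 0..<n. complex_of_real (A $$ (j, i)) * v $ j) = \<mu> * v $ i" if "i < n" for i
    using arg_cong[OF v(3), of "\<lambda>w. w $ i"] that A v(1) by (simp add: scalar_prod_def)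
  have Aa: "A\<^sup>T *\<^sub>v a = Re \<mu> \<cdot>\<^sub>v a - Im \<mu> \<cdot>\<^sub>v b"
  proof (intro eq_vecI)
    fix i assume "i < dim_vec (Re \<mu> \<cdot>\<^sub>v a - Im \<mu> \<cdot>\<^sub>v b)"
    then have i: "i < n" using ab by simp
    show "(A\<^sup>T *\<^sub>v a) $ i = (Re \<mu> \<cdot>\<^sub>v a - Im \<mu> \<cdot>\<^sub>v b) $ i"
      using arg_cong[OF comp[OF i], of Re] i A v(1) by (simp add: scalar_prod_def a_def b_def)
  qed (use A ab in auto)
  have Ab: "A\<^sup>T *\<^sub>v b = Re \<mu> \<cdot>\<^sub>v b + Im \<mu> \<cdot>\<^sub>v a"
  proof (intro eq_vecI)
    fix i assume "i < dim_vec (Re \<mu> \<cdot>\<^sub>v b + Im \<mu> \<cdot>\<^sub>v a)"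
    then have i: "i < n" using ab by simp
    show "(A\<^sup>T *\<^sub>v b) $ i = (Re \<mu> \<cdot>\<^sub>v b + Im \<mu> \<cdot>\<^sub>v a) $ i"
      using arg_cong[OF comp[OF i], of Im] i A v(1) by (simp add: scalar_prod_def a_def b_def)
  qed (use A ab in auto)
  have "a \<noteq> 0\<^sub>v n \<or> b \<noteq> 0\<^sub>v n"
  proof (rule ccontr)
    assume "\<not> ?thesis"
    then have ab0: "a = 0\<^sub>v n" "b = 0\<^sub>v n" by auto
    have "v = 0\<^sub>v n"
    proof (rule eq_vecI)
      fix i assume "i < dim_vec (0\<^sub>v n :: complex vec)"
      then show "v $ i = 0\<^sub>v n $ i"
        using arg_cong[OF ab0(1), of "\<lambda>w. w $ i"] arg_cong[OF ab0(2), of "\<lambda>w. w $ i"] v(1)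
        by (simp add: a_def b_def complex_eq_iff)
    qed (use v in auto)
    with v(2) show False by simp
  qed
  \<comment> \<open>One of \<open>a\<close> and \<open>b\<close> may vanish, as for a real
    eigenvector. The weak inequality covers that part, and the nonzero part makes the sum
    strict.\<close>
  moreover have "quad X (A\<^sup>T *\<^sub>v w) \<le> quad X w" if "w \<in> carrier_vec n" for w
    using decr[OF that] A X
    by (cases "w = 0\<^sub>v n") (auto simp: quad_def mult_mat_zero_vec[of _ n n])
  ultimately have "quad X (A\<^sup>T *\<^sub>v a) + quad X (A\<^sup>T *\<^sub>v b) < quad X a + quad X b"
    using decr[OF ab(1)] decr[OF ab(2)] ab by (smt (verit))
  then have "(cmod \<mu>)\<^sup>2 * (quad X a + quad X b) < quad X a + quad X b"
    unfolding Aa Ab quad_rotation[OF X(1) ab] by (simp add: cmod_power2)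
  moreover have "quad X a + quad X b \<ge> 0"
    using pos_def_quad_nonneg[OF X(2,1)] ab by (simp add: add_nonneg_nonneg)
  \<comment> \<open>Otherwise multiplying the nonnegative number \<open>quad X a + quad X b\<close>
    by \<open>(cmod \<mu>)\<^sup>2\<close> could not make it smaller.\<close>
  ultimately have "(cmod \<mu>)\<^sup>2 < 1"
    by (smt (verit) mult_right_mono mult_cancel_right1)
  then show "cmod \<mu> < 1" by (simp add: power_less_one_iff abs_square_less_1)
qed

section \<open>The H2-norm bound from a Lyapunov inequality\<close>

text \<open>Powers are defined with the new factor on the right; transposing powers and iterating
  \<open>A\<^sup>T\<close> on a vector need it on the left.\<close>

lemma pow_mat_Suc_left:
  assumes "(A :: 'a :: semiring_1 mat) \<in> carrier_mat n n"
  shows "A ^\<^sub>m Suc k = A * A ^\<^sub>m k"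
proof (induction k)
  case 0
  then show ?case using assms by simp
next
  case (Suc k)
  have "A ^\<^sub>m Suc (Suc k) = (A * A ^\<^sub>m k) * A" using Suc by simp
  also have "\<dots> = A * A ^\<^sub>m Suc k"
    using assms pow_carrier_mat[OF assms, of k] by (simp add: assoc_mult_mat[of _ n n _ n _ n])
  finally show ?case .
qed

lemma transpose_pow_mat:
  assumes "(A :: 'a :: comm_semiring_1 mat) \<in> carrier_mat n n"
  shows "(A ^\<^sub>m k)\<^sup>T = A\<^sup>T ^\<^sub>m k"
proof (induction k)
  case 0
  then show ?case using assms by simp
next
  case (Suc k)
  have "(A ^\<^sub>m Suc k)\<^sup>T = A\<^sup>T * (A ^\<^sub>m k)\<^sup>T"
    using assms pow_carrier_mat[OF assms, of k] by (simp add: transpose_mult[of _ n n])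
  then show ?case using Suc pow_mat_Suc_left[of "A\<^sup>T" n k] assms by simp
qed

lemma scalar_prod_self_nonneg: "(v :: real vec) \<bullet> v \<ge> 0"
  by (simp add: scalar_prod_def sum_nonneg)

text \<open>The k-th term of the series is \<open>W * W\<^sup>T\<close> with
  \<open>W = C * A ^\<^sub>m k * B\<close>, so its diagonal entries are squared norms of rows of
  \<open>W\<close>.\<close>

lemma gramian_diag_entry:
  fixes A B C :: "real mat" and k :: nat
  assumes A: "A \<in> carrier_mat n n" and B: "B \<in> carrier_mat n nd" and C: "C \<in> carrier_mat ne n"
    and i: "i < ne"
  defines "v \<equiv> B\<^sup>T *\<^sub>v (A\<^sup>T ^\<^sub>m k *\<^sub>v row C i)"
  shows "(C * A ^\<^sub>m k * B * B\<^sup>T * A\<^sup>T ^\<^sub>m k * C\<^sup>T) $$ (i, i) = v \<bullet> v"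
proof -
  have Ak: "A ^\<^sub>m k \<in> carrier_mat n n" "A\<^sup>T ^\<^sub>m k \<in> carrier_mat n n" using A by auto
  define W where "W = C * A ^\<^sub>m k * B"
  have W: "W \<in> carrier_mat ne nd" unfolding W_def using A B C Ak by auto
  have WT: "W\<^sup>T = B\<^sup>T * (A\<^sup>T ^\<^sub>m k * C\<^sup>T)"
    unfolding W_def using A B C Ak
    by (simp add: transpose_mult[OF C Ak(1)] transpose_mult[of _ ne n _ nd] transpose_pow_mat[OF A])
  have "C * A ^\<^sub>m k * B * B\<^sup>T * A\<^sup>T ^\<^sub>m k * C\<^sup>T = W * W\<^sup>T"
    unfolding WT W_def[symmetric] using W B C Ak
    by (simp add: assoc_mult_mat[of _ ne nd _ n] assoc_mult_mat[of _ ne nd _ n _ ne]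
        assoc_mult_mat[of _ nd n _ n _ ne])
  then have "(C * A ^\<^sub>m k * B * B\<^sup>T * A\<^sup>T ^\<^sub>m k * C\<^sup>T) $$ (i, i) = col (W\<^sup>T) i \<bullet> col (W\<^sup>T) i"
    using W i by simp
  also have "col (W\<^sup>T) i = v"
  proof -
    have "col (W\<^sup>T) i = B\<^sup>T *\<^sub>v col (A\<^sup>T ^\<^sub>m k * C\<^sup>T) i"
      unfolding WT using B C Ak i by (intro col_mult2[of _ nd n _ ne]) auto
    also have "col (A\<^sup>T ^\<^sub>m k * C\<^sup>T) i = A\<^sup>T ^\<^sub>m k *\<^sub>v col (C\<^sup>T) i"
      using C Ak i by (intro col_mult2[of _ n n _ ne]) auto
    also have "col (C\<^sup>T) i = row C i" using C i by simp
    finally show ?thesis unfolding v_def .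
  qed
  finally show ?thesis .
qed

text \<open>Along \<open>w k\<close>, the iterates of \<open>A\<^sup>T\<close> on a row of
  \<open>C\<close>, the inequality \<open>decr\<close> bounds each term of the series by the loss of
  \<open>quad X\<close> in one step. The losses telescope, and adding the bounds over all rows gives
  the trace of \<open>C * X * C\<^sup>T\<close>. A weak \<open>decr\<close> suffices because the
  trace bound is strict.\<close>

lemma h2_norm_less_if_lyapunov:
  assumes A: "A \<in> carrier_mat n n" and B: "B \<in> carrier_mat n nd" and C: "C \<in> carrier_mat ne n"
    and X: "X \<in> carrier_mat n n" "pos_def X"
    and decr: "\<And>v. v \<in> carrier_vec n \<Longrightarrow> quad X (A\<^sup>T *\<^sub>v v) + (B\<^sup>T *\<^sub>v v) \<bullet> (B\<^sup>T *\<^sub>v v) \<le> quad X v"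
    and tr: "mat_trace (C * X * C\<^sup>T) < \<gamma>\<^sup>2" and \<gamma>: "\<gamma> > 0"
  shows "h2_norm A B C < \<gamma>"
proof -
  let ?g = "\<lambda>k i. (C * A ^\<^sub>m k * B * B\<^sup>T * A\<^sup>T ^\<^sub>m k * C\<^sup>T) $$ (i, i)"
  have bound: "(\<Sum>k. ?g k i) \<le> quad X (row C i)" if i: "i < ne" for i
  proof -
    define w where "w k = A\<^sup>T ^\<^sub>m k *\<^sub>v row C i" for k
    have r: "row C i \<in> carrier_vec n" using C i by auto
    have At: "A\<^sup>T \<in> carrier_mat n n" using A by simp
    have w: "w k \<in> carrier_vec n" for k
      unfolding w_def using pow_carrier_mat[OF At, of k] r by auto
    have w_Suc: "w (Suc k) = A\<^sup>T *\<^sub>v w k" for k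
      unfolding w_def pow_mat_Suc_left[OF At]
      using At pow_carrier_mat[OF At, of k] r by (intro assoc_mult_mat_vec) auto
    have g: "?g k i = (B\<^sup>T *\<^sub>v w k) \<bullet> (B\<^sup>T *\<^sub>v w k)" for k
      unfolding w_def by (rule gramian_diag_entry[OF A B C i])
    have partial: "(\<Sum>k<K. ?g k i) \<le> quad X (w 0) - quad X (w K)" for K
    proof (induction K)
      case (Suc K)
      then show ?case using decr[OF w[of K]] by (simp add: g w_Suc)
    qed simp
    have bd: "(\<Sum>k<K. ?g k i) \<le> quad X (row C i)" for K
      using partial[of K] pos_def_quad_nonneg[OF X(2,1) w[of K]] r At by (simp add: w_def)
    \<comment> \<open>Convergence follows from nonnegative terms with bounded partial sums, so
      \<open>suminf\<close> has its intended value here.\<close>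
    have "summable (\<lambda>k. ?g k i)"
      by (rule summableI_nonneg_bounded[OF _ bd]) (simp only: g scalar_prod_self_nonneg)
    then show ?thesis using bd by (rule suminf_le_const)
  qed
  have "mat_trace (mat (dim_row C) (dim_row C)
       (\<lambda>ij. \<Sum>k. (C * A ^\<^sub>m k * B * B\<^sup>T * (A\<^sup>T) ^\<^sub>m k * C\<^sup>T) $$ ij)) = (\<Sum>i<ne. \<Sum>k. ?g k i)"
    using C by (simp add: mat_trace_def)
  also have "\<dots> \<le> (\<Sum>i<ne. quad X (row C i))"
    by (intro sum_mono bound) simp
  also have "\<dots> = mat_trace (C * X * C\<^sup>T)"
  proof -
    have "(C * X * C\<^sup>T) $$ (i, i) = quad X (row C i)" if "i < ne" for i
    proof -
      have "C * X * C\<^sup>T = C * (X * C\<^sup>T)" using C X by (simp add: assoc_mult_mat[of _ ne n _ n _ ne])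
      moreover have "(C * (X * C\<^sup>T)) $$ (i, i) = row C i \<bullet> col (X * C\<^sup>T) i"
        using C X that by simp
      moreover have "col (X * C\<^sup>T) i = X *\<^sub>v col (C\<^sup>T) i"
        using C X that by (intro col_mult2[of _ n n _ ne]) auto
      moreover have "col (C\<^sup>T) i = row C i" using C that by simp
      ultimately show ?thesis unfolding quad_def by simp
    qed
    then show ?thesis using C by (simp add: mat_trace_def)
  qed
  also have "\<dots> < \<gamma>\<^sup>2" by (rule tr)
  finally have "h2_norm A B C < sqrt (\<gamma>\<^sup>2)"
    unfolding h2_norm_def by (rule real_sqrt_less_mono)
  then show ?thesis using \<gamma> by simp
qed

section \<open>Block columns of block diagonal matrices\<close>

lemma block_offset_le:
  fixes b :: "nat \<Rightarrow> nat"
  assumes "j < l"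
  shows "(\<Sum>t<j. b t) + b j \<le> (\<Sum>t<l. b t)"
proof -
  have "(\<Sum>t<Suc j. b t) \<le> (\<Sum>t<l. b t)" using assms by (intro sum_mono2) auto
  then show ?thesis by simp
qed

lemma block_col_carrier: "T \<in> carrier_mat r c \<Longrightarrow> block_col T b j \<in> carrier_mat r (b j)"
  by (simp add: block_col_def)

lemma diag_block_mat_upt_carrier:
  assumes "\<And>j. j < l \<Longrightarrow> D j \<in> carrier_mat (p j) (q j)"
  shows "diag_block_mat (map D [0..<l]) \<in> carrier_mat (\<Sum>j<l. p j) (\<Sum>j<l. q j)"
proof -
  have "sum_list (map dim_row (map D [0..<l])) = (\<Sum>j<l. p j)"
    "sum_list (map dim_col (map D [0..<l])) = (\<Sum>j<l. q j)"
    using assms by (auto simp: sum_list_distinct_conv_sum_set o_def atLeast0LessThan intro!: sum.cong)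
  then show ?thesis by (intro carrier_matI) (simp_all only: dim_diag_block_mat)
qed

text \<open>The j-th block column of a block diagonal matrix contains only \<open>D j\<close>,
  located in the j-th block row. In the notation of the uncertainty structure this is \<Delta> L_j =
  R_j \<Delta>_j.\<close>

lemma diag_block_mat_times_block_col:
  fixes D :: "nat \<Rightarrow> real mat"
  assumes D: "\<And>j. j < l \<Longrightarrow> D j \<in> carrier_mat (p j) (q j)" and j: "j < l"
  shows "diag_block_mat (map D [0..<l]) * block_col (1\<^sub>m (\<Sum>t<l. q t)) q j
    = block_col (1\<^sub>m (\<Sum>t<l. p t)) p j * D j"
    (is "?D * ?L = ?R * D j")
proof -
  let ?P = "diag_block_mat (map D [0..<j])" and ?Q = "diag_block_mat (map D [Suc j..<l])"
  \<comment> \<open>Isolating index \<open>j\<close> exhibits the matrix as two nested two-by-two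
    block matrices with \<open>D j\<close> in the middle, from which \<open>entry\<close> is read
    off.\<close>
  have split: "map D [0..<l] = map D [0..<j] @ (D j # map D [Suc j..<l])"
    using upt_add_eq_append[of 0 j "l - j"] j by (simp add: upt_conv_Cons)
  have Dc: "?D \<in> carrier_mat (\<Sum>t<l. p t) (\<Sum>t<l. q t)"
    using D by (rule diag_block_mat_upt_carrier)
  have Pc: "?P \<in> carrier_mat (\<Sum>t<j. p t) (\<Sum>t<j. q t)"
    using D j by (intro diag_block_mat_upt_carrier) auto
  have eq: "?D = four_block_mat ?P (0\<^sub>m (dim_row ?P) (q j + dim_col ?Q)) (0\<^sub>m (p j + dim_row ?Q) (dim_col ?P))
     (four_block_mat (D j) (0\<^sub>m (p j) (dim_col ?Q)) (0\<^sub>m (dim_row ?Q) (q j)) ?Q)"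
    unfolding split diag_block_mat_append using D[OF j] by (simp add: Let_def)
  have dims: "dim_row ?P = (\<Sum>t<j. p t)" "dim_col ?P = (\<Sum>t<j. q t)" "dim_row (D j) = p j" "dim_col (D j) = q j"
    using Pc D[OF j] by auto
  have rows: "(\<Sum>t<l. p t) = (\<Sum>t<j. p t) + p j + dim_row ?Q"
    using arg_cong[OF eq, of dim_row] Dc dims by auto
  have entry: "?D $$ (i, (\<Sum>t<j. q t) + k) =
      (if i < (\<Sum>t<j. p t) then 0 else if i < (\<Sum>t<j. p t) + p j then D j $$ (i - (\<Sum>t<j. p t), k) else 0)"
    if "i < (\<Sum>t<l. p t)" "k < q j" for i k
    unfolding eq using that dims rows by auto
  note pj = block_offset_le[OF j, of p] and qj = block_offset_le[OF j, of q]
  show ?thesis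
  proof (rule eq_matI)
    fix i k assume "i < dim_row (?R * D j)" "k < dim_col (?R * D j)"
    then have i: "i < (\<Sum>t<l. p t)" and k: "k < q j" using dims by (auto simp: block_col_def)
    \<comment> \<open>Column \<open>k\<close> of \<open>?L\<close> is a unit vector, so the product
      selects the column of \<open>?D\<close> at offset plus \<open>k\<close>.\<close>
    have "(?D * ?L) $$ (i, k) = (\<Sum>s = 0..<(\<Sum>t<l. q t). ?D $$ (i, s) * (if s = (\<Sum>t<j. q t) + k then 1 else 0))"
      using Dc i k qj by (auto simp: block_col_def scalar_prod_def intro!: sum.cong)
    also have "\<dots> = ?D $$ (i, (\<Sum>t<j. q t) + k)"
      using k qj by (simp add: if_distrib sum.delta cong: if_cong)
    \<comment> \<open>The selected entry is spread into a sum over the rows of \<open>D j\<close> to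
      match the product with \<open>?R\<close>. The guard on \<open>i\<close> is essential: for
      \<open>i\<close> above the block, truncated subtraction gives 0 and would wrongly select
      \<open>s = 0\<close>.\<close>
    also have "\<dots> = (\<Sum>s = 0..<p j. (if s = i - (\<Sum>t<j. p t) \<and> i \<ge> (\<Sum>t<j. p t) then D j $$ (s, k) else 0))"
      unfolding entry[OF i k] by (auto simp: sum.delta)
    also have "\<dots> = (\<Sum>s = 0..<p j. (if i = (\<Sum>t<j. p t) + s then 1 else 0) * D j $$ (s, k))"
      by (intro sum.cong) auto
    also have "\<dots> = (?R * D j) $$ (i, k)"
      using dims i k pj by (auto simp: block_col_def scalar_prod_def intro!: sum.cong)
    finally show "(?D * ?L) $$ (i, k) = (?R * D j) $$ (i, k)" .
  qed (use Dc dims in \<open>auto simp: block_col_def\<close>)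
qed

section \<open>Nonnegativity of the multipliers on the graph of the uncertainty\<close>

text \<open>Each outer factor \<open>T j\<close> sends the test vector into the range of the matrix
  stacking \<Delta>_j transposed on the identity, exactly where membership in
  \<open>multiplier_set\<close> controls the form of \<open>Q j\<close>.\<close>

lemma prior_multipliers_quad_nonneg:
  assumes Bw: "Bw \<in> carrier_mat n nw"
    and nw: "nw = (\<Sum>j<l. nwb j)" and nz: "nz = (\<Sum>j<l. nzb j)"
    and Ps: "\<And>j. j < l \<Longrightarrow> Ps j \<subseteq> carrier_mat (nzb j + nwb j) (nzb j + nwb j)"
    and \<Delta>: "\<Delta> \<in> prior_set l nwb nzb Ps"
    and P: "P \<in> prior_multipliers l nwb nzb nz Bw Ps"
    and v: "v \<in> carrier_vec n"
  shows "quad P (\<Delta>\<^sup>T *\<^sub>v (Bw\<^sup>T *\<^sub>v v) @\<^sub>v v) \<ge> 0"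
proof -
  obtain \<Delta>s where \<Delta>_eq: "\<Delta> = diag_block_mat (map \<Delta>s [0..<l])"
    and \<Delta>s: "\<And>j. j < l \<Longrightarrow> \<Delta>s j \<in> multiplier_set (nwb j) (nzb j) (Ps j)"
    using \<Delta> by (auto simp: prior_set_def)
  have \<Delta>s_carrier: "\<Delta>s j \<in> carrier_mat (nwb j) (nzb j)" if "j < l" for j
    using \<Delta>s[OF that] by (simp add: multiplier_set_def)
  have \<Delta>_carrier: "\<Delta> \<in> carrier_mat nw nz"
    unfolding \<Delta>_eq nw nz using \<Delta>s_carrier by (rule diag_block_mat_upt_carrier)
  define L where "L = block_col (1\<^sub>m nz :: real mat) nzb"
  define R where "R = block_col (1\<^sub>m nw :: real mat) nwb"
  define T where "T j = four_block_mat (L j)\<^sup>T (0\<^sub>m (nzb j) n) (0\<^sub>m (nwb j) nz) (Bw * R j)\<^sup>T" for j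
  obtain Q where Q: "\<And>j. j < l \<Longrightarrow> Q j \<in> Ps j"
    and P_eq: "P = mat_sum (nz + n) (nz + n) (\<lambda>j. congruence (T j) (Q j)) l"
    using P Bw unfolding prior_multipliers_def Let_def T_def L_def R_def by auto
  have L: "L j \<in> carrier_mat nz (nzb j)" and R: "R j \<in> carrier_mat nw (nwb j)" for j
    unfolding L_def R_def by (rule block_col_carrier[OF one_carrier_mat])+
  have T: "T j \<in> carrier_mat (nzb j + nwb j) (nz + n)" for j
    unfolding T_def using L[of j] R[of j] Bw by (intro four_block_carrier_mat) auto
  define y where "y = Bw\<^sup>T *\<^sub>v v"
  have y: "y \<in> carrier_vec nw" unfolding y_def using Bw v by auto
  define s where "s = \<Delta>\<^sup>T *\<^sub>v y @\<^sub>v v"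
  have s: "s \<in> carrier_vec (nz + n)" unfolding s_def using \<Delta>_carrier v y by auto
  have "quad (congruence (T j) (Q j)) s \<ge> 0" if j: "j < l" for j
  proof -
    note Lj = L[of j] and Rj = R[of j] and Dj = \<Delta>s_carrier[OF j]
    have Qj: "Q j \<in> carrier_mat (nzb j + nwb j) (nzb j + nwb j)" using Q[OF j] Ps[OF j] by auto
    \<comment> \<open>The block identity lets \<open>(L j)\<^sup>T\<close> extract from
      \<open>\<Delta>\<^sup>T *\<^sub>v y\<close> the contribution of the single block
      \<open>\<Delta>s j\<close>.\<close>
    have "(\<Delta> * L j)\<^sup>T = (R j * \<Delta>s j)\<^sup>T"
      unfolding \<Delta>_eq L_def R_def nw nz using diag_block_mat_times_block_col[OF \<Delta>s_carrier j] by simp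
    then have LR: "(L j)\<^sup>T * \<Delta>\<^sup>T = (\<Delta>s j)\<^sup>T * (R j)\<^sup>T"
      using \<Delta>_carrier Lj Rj Dj by (simp add: transpose_mult[of _ nw nz] transpose_mult[of _ nw "nwb j"])
    have "(L j)\<^sup>T *\<^sub>v (\<Delta>\<^sup>T *\<^sub>v y) = ((L j)\<^sup>T * \<Delta>\<^sup>T) *\<^sub>v y"
      using \<Delta>_carrier Lj y by (intro assoc_mult_mat_vec[symmetric, of _ "nzb j" nz _ nw]) auto
    also have "\<dots> = (\<Delta>s j)\<^sup>T *\<^sub>v ((R j)\<^sup>T *\<^sub>v y)"
      unfolding LR using Dj Rj y by (intro assoc_mult_mat_vec[of _ "nzb j" "nwb j" _ nw]) auto
    finally have upper: "(L j)\<^sup>T *\<^sub>v (\<Delta>\<^sup>T *\<^sub>v y) = (\<Delta>s j)\<^sup>T *\<^sub>v ((R j)\<^sup>T *\<^sub>v y)" .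
    have lower: "(Bw * R j)\<^sup>T *\<^sub>v v = (R j)\<^sup>T *\<^sub>v y"
      unfolding y_def transpose_mult[OF Bw Rj]
      using Rj Bw v by (intro assoc_mult_mat_vec[of _ "nwb j" nw _ n]) auto
    have Ry: "(R j)\<^sup>T *\<^sub>v y \<in> carrier_vec (nwb j)" using Rj y by auto
    have Ej: "(\<Delta>s j)\<^sup>T @\<^sub>r 1\<^sub>m (nwb j) \<in> carrier_mat (nzb j + nwb j) (nwb j)"
      using Dj by auto
    have "T j *\<^sub>v s = ((L j)\<^sup>T *\<^sub>v (\<Delta>\<^sup>T *\<^sub>v y) + 0\<^sub>m (nzb j) n *\<^sub>v v) @\<^sub>v
        (0\<^sub>m (nwb j) nz *\<^sub>v (\<Delta>\<^sup>T *\<^sub>v y) + (Bw * R j)\<^sup>T *\<^sub>v v)"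
      unfolding T_def s_def using Lj Rj Bw \<Delta>_carrier y v
      by (intro four_block_mat_mult_vec[of _ "nzb j" nz _ n _ "nwb j"]) auto
    also have "\<dots> = (\<Delta>s j)\<^sup>T *\<^sub>v ((R j)\<^sup>T *\<^sub>v y) @\<^sub>v (R j)\<^sup>T *\<^sub>v y"
      unfolding upper lower using Rj Bw Dj \<Delta>_carrier y v Ry by (simp add: zero_mat_mult_vec)
    also have "\<dots> = ((\<Delta>s j)\<^sup>T @\<^sub>r 1\<^sub>m (nwb j)) *\<^sub>v ((R j)\<^sup>T *\<^sub>v y)"
      using Dj Ry by (simp add: mat_mult_append[of _ "nzb j" "nwb j" _ "nwb j"])
    finally have "quad (congruence (T j) (Q j)) s
        = quad (congruence ((\<Delta>s j)\<^sup>T @\<^sub>r 1\<^sub>m (nwb j)) (Q j)) ((R j)\<^sup>T *\<^sub>v y)"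
      using quad_congruence[OF T Qj s]
        quad_congruence[OF Ej Qj Ry] by simp
    also have "\<dots> \<ge> 0"
      using \<Delta>s[OF j] Q[OF j]
      by (intro pos_semidefD[OF _ congruence_carrier[OF Ej] Ry]) (auto simp: multiplier_set_def)
    finally show ?thesis .
  qed
  moreover have "congruence (T j) (Q j) \<in> carrier_mat (nz + n) (nz + n)" if "j < l" for j
    by (rule congruence_carrier[OF T])
  ultimately show ?thesis
    unfolding P_eq y_def[symmetric] s_def[symmetric] using s by (auto simp: quad_mat_sum intro!: sum_nonneg)
qed

text \<open>A \<Delta> consistent with the data comes with some \<open>D\<close> in the disturbance
  set explaining \<open>M\<close>. It need not be the true disturbance; any such \<open>D\<close>
  allows the test vector to be mapped into the range of \<open>D\<^sup>T\<close> stacked on the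
  identity.\<close>

lemma data_multipliers_quad_nonneg:
  assumes Bw: "Bw \<in> carrier_mat n nw" and Bd: "Bd \<in> carrier_mat n nd" and Z: "Z \<in> carrier_mat nz N"
    and Pd: "Pd \<subseteq> carrier_mat (N + nd) (N + nd)"
    and \<Delta>: "\<Delta> \<in> learnt_set nw nz Bw Bd M Z (multiplier_set nd N Pd)"
    and P: "P \<in> data_multipliers Bd M Z Pd"
    and v: "v \<in> carrier_vec n"
  shows "quad P (\<Delta>\<^sup>T *\<^sub>v (Bw\<^sup>T *\<^sub>v v) @\<^sub>v v) \<ge> 0"
proof -
  obtain D where \<Delta>_carrier: "\<Delta> \<in> carrier_mat nw nz" and D: "D \<in> multiplier_set nd N Pd"
    and M_eq: "M = Bw * \<Delta> * Z + Bd * D"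
    using \<Delta> by (auto simp: learnt_set_def)
  have Dc: "D \<in> carrier_mat nd N" using D by (simp add: multiplier_set_def)
  have M: "M \<in> carrier_mat n N" unfolding M_eq using Bw Bd Z Dc \<Delta>_carrier by auto
  define T where "T = four_block_mat (- (Z\<^sup>T)) (M\<^sup>T) (0\<^sub>m nd nz) (Bd\<^sup>T)"
  obtain Q where Q: "Q \<in> Pd" and P_eq: "P = congruence T Q"
    using P Bd Z by (auto simp: data_multipliers_def T_def)
  have Qc: "Q \<in> carrier_mat (N + nd) (N + nd)" using Q Pd by auto
  have T: "T \<in> carrier_mat (N + nd) (nz + n)"
    unfolding T_def using Z M Bd by (intro four_block_carrier_mat) auto
  define q where "q = \<Delta>\<^sup>T *\<^sub>v (Bw\<^sup>T *\<^sub>v v)"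
  define y where "y = Bd\<^sup>T *\<^sub>v v"
  have q: "q \<in> carrier_vec nz" and y: "y \<in> carrier_vec nd"
    unfolding q_def y_def using Bw Bd \<Delta>_carrier v by auto
  have "M\<^sup>T = Z\<^sup>T * (\<Delta>\<^sup>T * Bw\<^sup>T) + D\<^sup>T * Bd\<^sup>T"
    unfolding M_eq using Bw Bd Z Dc \<Delta>_carrier
    by (simp add: transpose_add[of _ n N] transpose_mult[of _ n nw _ N] transpose_mult[of _ nw nz _ N]
        transpose_mult[of _ n nd _ N] assoc_mult_mat[of _ N nz _ nw _ n])
  then have "M\<^sup>T *\<^sub>v v = (Z\<^sup>T * (\<Delta>\<^sup>T * Bw\<^sup>T)) *\<^sub>v v + (D\<^sup>T * Bd\<^sup>T) *\<^sub>v v"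
    using Bw Bd Z Dc \<Delta>_carrier v by (simp add: add_mult_distrib_mat_vec[of _ N n])
  also have "(Z\<^sup>T * (\<Delta>\<^sup>T * Bw\<^sup>T)) *\<^sub>v v = Z\<^sup>T *\<^sub>v q"
    unfolding q_def using Bw Z \<Delta>_carrier v
    by (simp add: assoc_mult_mat_vec[of _ N nz _ n] assoc_mult_mat_vec[of _ nz nw _ n])
  also have "(D\<^sup>T * Bd\<^sup>T) *\<^sub>v v = D\<^sup>T *\<^sub>v y"
    unfolding y_def using Bd Dc v by (simp add: assoc_mult_mat_vec[of _ N nd _ n])
  finally have Mv: "M\<^sup>T *\<^sub>v v = Z\<^sup>T *\<^sub>v q + D\<^sup>T *\<^sub>v y" .
  have E: "D\<^sup>T @\<^sub>r 1\<^sub>m nd \<in> carrier_mat (N + nd) nd"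
    using Dc by auto
  have "T *\<^sub>v (q @\<^sub>v v) = (- (Z\<^sup>T) *\<^sub>v q + M\<^sup>T *\<^sub>v v) @\<^sub>v (0\<^sub>m nd nz *\<^sub>v q + Bd\<^sup>T *\<^sub>v v)"
    unfolding T_def using Z M Bd q v by (intro four_block_mat_mult_vec[of _ N nz _ n _ nd]) auto
  \<comment> \<open>The block \<open>- (Z\<^sup>T)\<close> cancels the contribution of \<Delta> to
    \<open>M\<^sup>T *\<^sub>v v\<close>, leaving only the disturbance.\<close>
  also have "- (Z\<^sup>T) *\<^sub>v q + M\<^sup>T *\<^sub>v v = D\<^sup>T *\<^sub>v y"
    unfolding Mv using Z Dc q y by (intro eq_vecI) (auto simp: uminus_mult_mat_vec)
  also have "0\<^sub>m nd nz *\<^sub>v q + Bd\<^sup>T *\<^sub>v v = y"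
    unfolding y_def[symmetric] using q y by (simp add: zero_mat_mult_vec)
  also have "D\<^sup>T *\<^sub>v y @\<^sub>v y = (D\<^sup>T @\<^sub>r 1\<^sub>m nd) *\<^sub>v y"
    using Dc y by (simp add: mat_mult_append[of _ N nd _ nd])
  finally have "quad P (q @\<^sub>v v) = quad (congruence (D\<^sup>T @\<^sub>r 1\<^sub>m nd) Q) y"
    unfolding P_eq using quad_congruence[OF T Qc append_carrier_vec[OF q v]]
      quad_congruence[OF E Qc y] by simp
  also have "\<dots> \<ge> 0"
    using D Q
    by (intro pos_semidefD[OF _ congruence_carrier[OF E] y]) (auto simp: multiplier_set_def)
  finally show ?thesis unfolding q_def .
qed

section \<open>Evaluation of the matrix inequality\<close>

text \<open>The outer factor maps (v, q) to v,
  \<open>F\<^sup>T *\<^sub>v v + H\<^sup>T *\<^sub>v q\<close>, q, v, and the block diagonal middle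
  matrix separates the form. The lower half \<open>G2\<close> exchanges the components, so
  \<open>P\<close> is tested at (q, v).\<close>

lemma lmi_quad:
  assumes F: "F \<in> carrier_mat n n" and H: "H \<in> carrier_mat nz n" and S: "S \<in> carrier_mat n n"
    and X: "X \<in> carrier_mat n n" and P: "P \<in> carrier_mat (nz + n) (nz + n)"
    and v: "v \<in> carrier_vec n" and q: "q \<in> carrier_vec nz"
  defines "G \<equiv> four_block_mat (1\<^sub>m n) (0\<^sub>m n nz) F\<^sup>T H\<^sup>T @\<^sub>r four_block_mat (0\<^sub>m nz n) (1\<^sub>m nz) (1\<^sub>m n) (0\<^sub>m n nz)"
  shows "congruence G (diag_block_mat [S, X, P]) \<in> carrier_mat (n + nz) (n + nz)"
    and "quad (congruence G (diag_block_mat [S, X, P])) (v @\<^sub>v q)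
      = quad S v + quad X (F\<^sup>T *\<^sub>v v + H\<^sup>T *\<^sub>v q) + quad P (q @\<^sub>v v)"
proof -
  define G1 where "G1 = four_block_mat (1\<^sub>m n) (0\<^sub>m n nz) F\<^sup>T H\<^sup>T"
  define G2 where "G2 = four_block_mat (0\<^sub>m nz n) (1\<^sub>m nz) (1\<^sub>m n) (0\<^sub>m n nz :: real mat)"
  have G1: "G1 \<in> carrier_mat (n + n) (n + nz)" unfolding G1_def using F H by auto
  have G2: "G2 \<in> carrier_mat (nz + n) (n + nz)"
    by (rule carrier_matI) (auto simp: G2_def)
  have G_eq: "G = G1 @\<^sub>r G2" by (simp add: G_def G1_def G2_def)
  have G: "G \<in> carrier_mat (n + (n + (nz + n))) (n + nz)"
    unfolding G_eq using carrier_append_rows[OF G1 G2] by (simp add: add.assoc)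
  have Dg: "diag_block_mat [S, X, P] = four_block_mat S (0\<^sub>m n (n + (nz + n))) (0\<^sub>m (n + (nz + n)) n)
      (four_block_mat X (0\<^sub>m n (nz + n)) (0\<^sub>m (nz + n) n) P)"
    using S X P by (auto simp: Let_def)
  have XP: "four_block_mat X (0\<^sub>m n (nz + n)) (0\<^sub>m (nz + n) n) P \<in> carrier_mat (n + (nz + n)) (n + (nz + n))"
    using X P by (intro four_block_carrier_mat) auto
  have Dgc: "diag_block_mat [S, X, P] \<in> carrier_mat (n + (n + (nz + n))) (n + (n + (nz + n)))"
    unfolding Dg by (rule four_block_carrier_mat[OF S XP])
  show "congruence G (diag_block_mat [S, X, P]) \<in> carrier_mat (n + nz) (n + nz)"
    by (rule congruence_carrier[OF G])
  define w where "w = F\<^sup>T *\<^sub>v v + H\<^sup>T *\<^sub>v q"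
  have w: "w \<in> carrier_vec n" unfolding w_def using F H v q by auto
  have vq: "v @\<^sub>v q \<in> carrier_vec (n + nz)" using v q by auto
  have "G1 *\<^sub>v (v @\<^sub>v q) = (1\<^sub>m n *\<^sub>v v + 0\<^sub>m n nz *\<^sub>v q) @\<^sub>v w"
    unfolding G1_def w_def using F H v q by (intro four_block_mat_mult_vec[of _ n n _ nz _ n]) auto
  also have "\<dots> = v @\<^sub>v w" using v q by (simp add: zero_mat_mult_vec)
  finally have 1: "G1 *\<^sub>v (v @\<^sub>v q) = v @\<^sub>v w" .
  have "G2 *\<^sub>v (v @\<^sub>v q) = (0\<^sub>m nz n *\<^sub>v v + 1\<^sub>m nz *\<^sub>v q) @\<^sub>v (1\<^sub>m n *\<^sub>v v + 0\<^sub>m n nz *\<^sub>v q)"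
    unfolding G2_def using v q by (intro four_block_mat_mult_vec[of _ nz n _ nz _ n]) auto
  also have "\<dots> = q @\<^sub>v v" using v q by (simp add: zero_mat_mult_vec)
  finally have 2: "G2 *\<^sub>v (v @\<^sub>v q) = q @\<^sub>v v" .
  have "G *\<^sub>v (v @\<^sub>v q) = (v @\<^sub>v w) @\<^sub>v (q @\<^sub>v v)"
    unfolding G_eq mat_mult_append[OF G1 G2 vq] 1 2 ..
  \<comment> \<open>Reassociated to the right, as \<open>diag_block_mat\<close> nests its
    blocks.\<close>
  also have "\<dots> = v @\<^sub>v (w @\<^sub>v (q @\<^sub>v v))"
    using v w q by (intro eq_vecI) auto
  finally have "quad (congruence G (diag_block_mat [S, X, P])) (v @\<^sub>v q)
      = quad (diag_block_mat [S, X, P]) (v @\<^sub>v (w @\<^sub>v (q @\<^sub>v v)))"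
    using quad_congruence[OF G Dgc vq] by simp
  also have "\<dots> = quad S v + (quad X w + quad P (q @\<^sub>v v))"
    unfolding Dg using v w q
    by (simp only: quad_block_diag[OF S XP] quad_block_diag[OF X P] append_carrier_vec)
  finally show "quad (congruence G (diag_block_mat [S, X, P])) (v @\<^sub>v q)
      = quad S v + quad X (F\<^sup>T *\<^sub>v v + H\<^sup>T *\<^sub>v q) + quad P (q @\<^sub>v v)"
    by (simp add: w_def)
qed

section \<open>Robust stability and H2 performance of the closed loop\<close>

theorem theorem1:
  fixes n m nd ne nw nz N l :: nat
    and nwb nzb :: "nat \<Rightarrow> nat"
    and A B Bd Bw Ce Deu Ded Cz Dz :: "real mat"
    and Ps :: "nat \<Rightarrow> real mat set" and Pd :: "real mat set"
    and x u dhat e :: "nat \<Rightarrow> real vec"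
    and \<Delta>tr X Xp U M Z :: "real mat"
    and \<D> \<Delta>prior \<Delta>learnt \<Delta>com Pcom_set :: "real mat set"
    and \<X> K Pcom :: "real mat" and \<gamma> :: real
  assumes dims:
      "A \<in> carrier_mat n n" "B \<in> carrier_mat n m" "Bd \<in> carrier_mat n nd" "Bw \<in> carrier_mat n nw"
      "Ce \<in> carrier_mat ne n" "Deu \<in> carrier_mat ne m" "Ded \<in> carrier_mat ne nd"
      "Cz \<in> carrier_mat nz n" "Dz \<in> carrier_mat nz m"
    and Bd_rank: "vec_space.rank n Bd = nd"
    and blocks: "nw = (\<Sum>j<l. nwb j)" "nz = (\<Sum>j<l. nzb j)"
    and Bj_rank: "\<forall>j<l. vec_space.rank n (Bw * block_col (1\<^sub>m nw) nwb j) = nwb j"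
    and A1: "\<forall>j<l. multiplier_cone (nzb j) (nwb j) (Ps j)"
    and A2: "multiplier_cone N nd Pd"
    and \<D>_def: "\<D> = multiplier_set nd N Pd"
    and \<Delta>prior_def: "\<Delta>prior = prior_set l nwb nzb Ps"
    and data_gen: "trajectory A B Bd Bw Ce Deu Ded Cz Dz \<Delta>tr N x u dhat e"
      "\<Delta>tr \<in> \<Delta>prior" "mat_of_cols nd (map dhat [0..<N]) \<in> \<D>"
    and data_mats: "X = mat_of_cols n (map x [0..<N])"
      "Xp = mat_of_cols n (map (\<lambda>k. x (Suc k)) [0..<N])"
      "U = mat_of_cols m (map u [0..<N])"
      "M = Xp - A * X - B * U"
      "Z = Cz * X + Dz * U"
    and \<Delta>learnt_def: "\<Delta>learnt = learnt_set nw nz Bw Bd M Z \<D>"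
    and \<Delta>com_def: "\<Delta>com = \<Delta>prior \<inter> \<Delta>learnt"
    and Pcom_set_def: "Pcom_set =
      minkowski_sum (prior_multipliers l nwb nzb nz Bw Ps) (data_multipliers Bd M Z Pd)"
    and Ded_zero: "Ded = 0\<^sub>m ne nd"
    and \<X>: "\<X> \<in> carrier_mat n n" "pos_def \<X>"
    and K: "K \<in> carrier_mat m n"
    and Pcom: "Pcom \<in> Pcom_set"
    and \<gamma>: "\<gamma> > 0"
    and trace_ineq: "mat_trace ((Ce + Deu * K) * \<X> * (Ce + Deu * K)\<^sup>T) < \<gamma>\<^sup>2"
    and lmi: "neg_def (congruence
      (four_block_mat (1\<^sub>m n) (0\<^sub>m n nz) (A + B * K)\<^sup>T (Cz + Dz * K)\<^sup>T
        @\<^sub>r four_block_mat (0\<^sub>m nz n) (1\<^sub>m nz) (1\<^sub>m n) (0\<^sub>m n nz))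
      (diag_block_mat [Bd * Bd\<^sup>T - \<X>, \<X>, Pcom]))"
  shows "\<forall>\<Delta> \<in> \<Delta>com.
    schur_stable (A + B * K + Bw * \<Delta> * (Cz + Dz * K)) \<and>
    h2_norm (A + B * K + Bw * \<Delta> * (Cz + Dz * K)) Bd (Ce + Deu * K) < \<gamma>"
proof
  fix \<Delta> assume "\<Delta> \<in> \<Delta>com"
  then have prior: "\<Delta> \<in> prior_set l nwb nzb Ps"
    and learnt: "\<Delta> \<in> learnt_set nw nz Bw Bd M Z (multiplier_set nd N Pd)"
    by (auto simp: \<Delta>com_def \<Delta>prior_def \<Delta>learnt_def \<D>_def)
  have \<Delta>: "\<Delta> \<in> carrier_mat nw nz" using learnt by (simp add: learnt_set_def)
  have Z: "Z \<in> carrier_mat nz N" unfolding data_mats using dims by auto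
  have Ps: "Ps j \<subseteq> carrier_mat (nzb j + nwb j) (nzb j + nwb j)" if "j < l" for j
    using A1 that by (auto simp: multiplier_cone_def sym_mats_def)
  have Pd: "Pd \<subseteq> carrier_mat (N + nd) (N + nd)"
    using A2 by (auto simp: multiplier_cone_def sym_mats_def)
  obtain P1 P2 where P1: "P1 \<in> prior_multipliers l nwb nzb nz Bw Ps"
    and P2: "P2 \<in> data_multipliers Bd M Z Pd" and Pcom_eq: "Pcom = P1 + P2"
    using Pcom unfolding Pcom_set_def minkowski_sum_def by auto
  have P1c: "P1 \<in> carrier_mat (nz + n) (nz + n)"
    using P1 dims by (auto simp: prior_multipliers_def mat_sum_def)
  have P2c: "P2 \<in> carrier_mat (nz + n) (nz + n)"
    using P2 Z data_mats(4) dims data_mats(1) by (auto simp: data_multipliers_def congruence_def)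
  have Pc: "Pcom \<in> carrier_mat (nz + n) (nz + n)" unfolding Pcom_eq using P2c by auto
  define F where "F = A + B * K"
  define H where "H = Cz + Dz * K"
  define Acl where "Acl = F + Bw * \<Delta> * H"
  have F: "F \<in> carrier_mat n n" and H: "H \<in> carrier_mat nz n"
    using dims K by (auto simp: F_def H_def)
  have Acl: "Acl \<in> carrier_mat n n" unfolding Acl_def using F H dims \<Delta> by auto
  have BB: "Bd * Bd\<^sup>T \<in> carrier_mat n n" using dims by auto
  have S: "Bd * Bd\<^sup>T - \<X> \<in> carrier_mat n n" using \<X> by auto
  \<comment> \<open>The closed-loop Lyapunov inequality, from which both conclusions follow.\<close>
  have decr: "quad \<X> (Acl\<^sup>T *\<^sub>v v) + (Bd\<^sup>T *\<^sub>v v) \<bullet> (Bd\<^sup>T *\<^sub>v v) < quad \<X> v"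
    if v: "v \<in> carrier_vec n" "v \<noteq> 0\<^sub>v n" for v
  proof -
    define q where "q = \<Delta>\<^sup>T *\<^sub>v (Bw\<^sup>T *\<^sub>v v)"
    have q: "q \<in> carrier_vec nz" unfolding q_def using \<Delta> dims v by auto
    \<comment> \<open>Strict negativity applies only to nonzero vectors; here the first component is
      already nonzero, whatever \<open>q\<close> is.\<close>
    have "v @\<^sub>v q \<noteq> 0\<^sub>v (n + nz)"
    proof
      assume vq0: "v @\<^sub>v q = 0\<^sub>v (n + nz)"
      have "v = 0\<^sub>v n"
      proof (rule eq_vecI)
        fix i assume "i < dim_vec (0\<^sub>v n :: real vec)"
        then show "v $ i = 0\<^sub>v n $ i"
          using arg_cong[OF vq0, of "\<lambda>w. w $ i"] v(1) q by simp
      qed (use v(1) in simp)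
      with v(2) show False by simp
    qed
    then have "quad (Bd * Bd\<^sup>T - \<X>) v + quad \<X> (F\<^sup>T *\<^sub>v v + H\<^sup>T *\<^sub>v q) + quad Pcom (q @\<^sub>v v) < 0"
      using neg_defD[OF lmi[folded F_def H_def] lmi_quad(1)[OF F H S \<X>(1) Pc v(1) q]
          append_carrier_vec[OF v(1) q]]
      unfolding lmi_quad(2)[OF F H S \<X>(1) Pc v(1) q] by blast
    moreover have "quad Pcom (q @\<^sub>v v) \<ge> 0"
      unfolding Pcom_eq quad_add[OF P1c P2c append_carrier_vec[OF q v(1)]]
      using prior_multipliers_quad_nonneg[OF dims(4) blocks Ps prior P1 v(1)]
        data_multipliers_quad_nonneg[OF dims(4) dims(3) Z Pd learnt P2 v(1)]
      unfolding q_def by (rule add_nonneg_nonneg)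
    \<comment> \<open>The choice of \<open>q\<close> closes the loop through \<Delta>: the argument
      of \<open>\<X>\<close> becomes the transposed closed-loop matrix applied to
      \<open>v\<close>.\<close>
    moreover have "F\<^sup>T *\<^sub>v v + H\<^sup>T *\<^sub>v q = Acl\<^sup>T *\<^sub>v v"
    proof -
      have "Acl\<^sup>T = F\<^sup>T + H\<^sup>T * (\<Delta>\<^sup>T * Bw\<^sup>T)"
        unfolding Acl_def using F H dims(4) \<Delta>
        by (simp add: transpose_add[of _ n n] transpose_mult[of _ n nw _ n] transpose_mult[of _ nw nz _ n]
            assoc_mult_mat[of _ n nz _ nw _ n])
      then show ?thesis
        unfolding q_def using F H dims(4) \<Delta> v
        by (simp add: add_mult_distrib_mat_vec[of _ n n] assoc_mult_mat_vec[of _ n nz _ n]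
            assoc_mult_mat_vec[of _ nz nw _ n])
    qed
    ultimately show ?thesis
      using quad_minus[OF BB \<X>(1) v(1)] quad_gram[OF dims(3) v(1)] by simp
  qed
  have "schur_stable Acl"
  proof (rule schur_stable_if_lyapunov[OF Acl \<X>])
    fix v :: "real vec" assume "v \<in> carrier_vec n" "v \<noteq> 0\<^sub>v n"
    then show "quad \<X> (Acl\<^sup>T *\<^sub>v v) < quad \<X> v"
      using decr[of v] scalar_prod_self_nonneg[of "Bd\<^sup>T *\<^sub>v v"] by linarith
  qed
  moreover have "h2_norm Acl Bd (Ce + Deu * K) < \<gamma>"
  proof (rule h2_norm_less_if_lyapunov[OF Acl dims(3) _ \<X> _ trace_ineq \<gamma>])
    show "Ce + Deu * K \<in> carrier_mat ne n" using dims K by auto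
    fix v :: "real vec" assume v: "v \<in> carrier_vec n"
    show "quad \<X> (Acl\<^sup>T *\<^sub>v v) + (Bd\<^sup>T *\<^sub>v v) \<bullet> (Bd\<^sup>T *\<^sub>v v) \<le> quad \<X> v"
    \<comment> \<open>The strict inequality \<open>decr\<close> excludes the zero vector, where both
      sides are 0.\<close>
    proof (cases "v = 0\<^sub>v n")
      case True
      then have "Acl\<^sup>T *\<^sub>v v = 0\<^sub>v n" "Bd\<^sup>T *\<^sub>v v = 0\<^sub>v nd"
        using Acl dims(3) mult_mat_zero_vec[of "Acl\<^sup>T" n n] mult_mat_zero_vec[of "Bd\<^sup>T" nd n] by auto
      with True show ?thesis using \<X>(1) by (simp add: quad_def)
    qed (use decr[OF v] in simp)
  qed
  ultimately show "schur_stable (A + B * K + Bw * \<Delta> * (Cz + Dz * K)) \<and>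
    h2_norm (A + B * K + Bw * \<Delta> * (Cz + Dz * K)) Bd (Ce + Deu * K) < \<gamma>"
    unfolding Acl_def F_def H_def by blast
qed

end
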